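(* Let $H(z)$ be a rational transfer function of McMillan degree $n$ with positive real poles, of the form $$H(z)=\frac{1}{z-1}+\sum_{j=1}^r\sum_{i=1}^{n_j}\frac{c_j^{(i)}}{(z-\lambda_j)^i},$$ where $c_j^{(i)}\in\mathbb{R}$, $0<\lambda_j<1$ (the $\lambda_j$ being pairwise distinct, $\lambda_j$ a pole of order $n_j$), and $\sum_{j=1}^r n_j=n-1$. Let $t_1,t_2,\dots$ be the impulse response sequence of $H(z)$, and assume that there exists a positive integer $k_0$ such that $t_{k_0}=0$ and $t_k>0$ for all $k>k_0$. Then the dimension $M$ of any cone-generated positive realization of $H(z)$ satisfies $$M\ge\frac{k_0}{n-1}.$$
   Context: The impulse response of a strictly proper rational transfer function $H(z)$ is the sequence $(t_k)_{k\ge1}$ of coefficients in the series expansion $H(z)=\sum_{k=1}^\infty t_kz^{-k}$ (at $z=\infty$). A realization of $H(z)$ of dimension (order) $M$ is a triple $(\mathbf{c},\mathbf{A},\mathbf{b})$ with $\mathbf{A}\in\mathbb{R}^{M\times M}$, $\mathbf{b},\mathbf{c}\in\mathbb{R}^M$ such that $H(z)=\mathbf{c}^T(z\mathbf{I}-\mathbf{A})^{-1}\mathbf{b}$. It is a positive realization if all entries of $\mathbf{A},\mathbf{b},\mathbf{c}$ are nonnegative. The McMillan degree $n$ of $H(z)$ is the smallest dimension of a (not necessarily positive) realization, equivalently the degree of the denominator of $H(z)$ in lowest terms; a realization of dimension $n$ is called minimal. Cone-generated realization: let $(\mathbf{h},\mathbf{F},\mathbf{g})$ be a minimal ($n$-dimensional)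 realization of $H(z)$, i.e. $\mathbf{F}\in\mathbb{R}^{n\times n}$, $\mathbf{g},\mathbf{h}\in\mathbb{R}^n$ and $H(z)=\mathbf{h}^T(z\mathbf{I}-\mathbf{F})^{-1}\mathbf{g}$. Suppose there are a real matrix $\mathbf{P}$ of size $n\times M$ and a triple $(\mathbf{c},\mathbf{A},\mathbf{b})$ with nonnegative entries, $\mathbf{A}\in\mathbb{R}^{M\times M}$, $\mathbf{b},\mathbf{c}\in\mathbb{R}^M$, such that $$\mathbf{F}\mathbf{P}=\mathbf{P}\mathbf{A},\qquad \mathbf{P}\mathbf{b}=\mathbf{g},\qquad \mathbf{c}^T=\mathbf{h}^T\mathbf{P}.$$ Then $(\mathbf{c},\mathbf{A},\mathbf{b})$ is a positive realization of $H(z)$; a triple $(\mathbf{c},\mathbf{A},\mathbf{b})$ arising in this manner is called a cone-generated (positive) realization of $H(z)$, of dimension $M$. *)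

theory Defs
  imports
    "HOL-Complex_Analysis.Complex_Singularities"
    "Jordan_Normal_Form.Gauss_Jordan_Elimination"
begin

text \<open>A transfer function is represented by its evaluation map on the complex plane; its value
  at a pole (an artefact of division by zero) is irrelevant. In particular \<open>realization\<close> asks for
  \<open>H z = c\<^sup>T (z I - A)\<^sup>-\<^sup>1 b\<close> at every \<open>z\<close> for which \<open>z I - A\<close> is invertible, i.e. off the finite
  spectrum of \<open>A\<close>. For rational functions this is the same as equality as rational functions,
  because every pole of the right-hand side is an eigenvalue of \<open>A\<close>.\<close>

definition impulse_response :: "(complex \<Rightarrow> complex) \<Rightarrow> (nat \<Rightarrow> real) \<Rightarrow> bool" where
  \<comment> \<open>the sequence is indexed from 1; the value at 0 plays no role\<close>
  "impulse_response H t \<longleftrightarrow>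
     (\<forall>\<^sub>F z in at_infinity. (\<lambda>k. complex_of_real (t (Suc k)) / z ^ Suc k) sums H z)"

definition realization ::
  "(complex \<Rightarrow> complex) \<Rightarrow> nat \<Rightarrow> real Matrix.vec \<Rightarrow> real mat \<Rightarrow> real Matrix.vec \<Rightarrow> bool" where
  "realization H M c A b \<longleftrightarrow>
     c \<in> carrier_vec M \<and> A \<in> carrier_mat M M \<and> b \<in> carrier_vec M \<and>
     (\<forall>z R. mat_inverse (z \<cdot>\<^sub>m 1\<^sub>m M - map_mat complex_of_real A) = Some R \<longrightarrow>
        H z = scalar_prod (map_vec complex_of_real c) (R *\<^sub>v map_vec complex_of_real b))"

definition mcmillan_degree :: "(complex \<Rightarrow> complex) \<Rightarrow> nat" where
  "mcmillan_degree H = (LEAST N. \<exists>c A b. realization H N c A b)"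

definition minimal_realization ::
  "(complex \<Rightarrow> complex) \<Rightarrow> nat \<Rightarrow> real Matrix.vec \<Rightarrow> real mat \<Rightarrow> real Matrix.vec \<Rightarrow> bool" where
  "minimal_realization H n h F g \<longleftrightarrow> realization H n h F g \<and> n = mcmillan_degree H"

definition nonneg_triple :: "real Matrix.vec \<Rightarrow> real mat \<Rightarrow> real Matrix.vec \<Rightarrow> bool" where
  "nonneg_triple c A b \<longleftrightarrow>
     (\<forall>i < dim_vec c. 0 \<le> vec_index c i) \<and>
     (\<forall>i < dim_row A. \<forall>j < dim_col A. 0 \<le> A $$ (i, j)) \<and>
     (\<forall>i < dim_vec b. 0 \<le> vec_index b i)"

definition cone_generated_realization ::
  "(complex \<Rightarrow> complex) \<Rightarrow> nat \<Rightarrow> real Matrix.vec \<Rightarrow> real mat \<Rightarrow> real Matrix.vec \<Rightarrow> bool" where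
  "cone_generated_realization H M c A b \<longleftrightarrow>
     c \<in> carrier_vec M \<and> A \<in> carrier_mat M M \<and> b \<in> carrier_vec M \<and> nonneg_triple c A b \<and>
     (\<exists>n h F g P. minimal_realization H n h F g \<and> P \<in> carrier_mat n M \<and>
        F * P = P * A \<and> P *\<^sub>v b = g \<and> c = transpose_mat P *\<^sub>v h)"

end

theory Submission
  imports Defs "Jordan_Normal_Form.Char_Poly"
begin

text \<open>The impulse response is \<open>t\<^bsub>k+1\<^esub> = c\<^sup>T A\<^sup>k b\<close>, where \<open>c\<close>, \<open>A\<close> and \<open>b\<close> are nonnegative. Splitting the
  power as \<open>c\<^sup>T A\<^sup>k\<close> times \<open>A\<^sup>l b\<close> with \<open>k + l = k0 - 1\<close> writes \<open>t\<^bsub>k0\<^esub> = 0\<close> as a sum of nonnegative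
  terms, one for each coordinate, so all of them vanish. With one more factor \<open>A\<close> the same sum
  becomes \<open>t\<^bsub>k0+1\<^esub> > 0\<close>, so some coordinate \<open>i\<close> has \<open>(A\<^sup>l b)\<^sub>i > 0\<close> and
  \<open>(c\<^sup>T A\<^bsup>k+1\<^esup>)\<^sub>i > 0\<close>, whence \<open>(c\<^sup>T A\<^sup>k)\<^sub>i = 0\<close>. Each of the \<open>k0\<close> exponents
  \<open>k = 0, ..., k0 - 1\<close> is thus a zero of one of the \<open>M\<close> sequences \<open>k \<mapsto> (c\<^sup>T A\<^sup>k)\<^sub>i\<close> that is not
  identically zero (\<open>annihilation_count\<close>), and it suffices that such a sequence has at most
  \<open>n - 1\<close> zeros.

  This is where the cone enters: \<open>c\<^sup>T A\<^sup>k = h\<^sup>T F\<^sup>k P\<close>, so by the theorem of Cayley and Hamilton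
  these sequences satisfy the linear recurrence given by the characteristic polynomial \<open>\<chi>\<close> of
  \<open>F\<close> (\<open>moment_char_poly_eq_0\<close>), which has degree \<open>n\<close> only. Since \<open>\<chi> H\<close> is a polynomial, the poles
  of \<open>H\<close> are roots of \<open>\<chi>\<close> of at least the same order, and their orders add up to \<open>n\<close>; hence all
  roots of \<open>\<chi>\<close> are real and positive (\<open>positive_roots_char_poly\<close>).

  Finally, a solution \<open>s\<close> of such a recurrence is a linear functional \<open>x\<^sup>k \<mapsto> s k\<close> on the
  \<open>n\<close>-dimensional space of polynomials modulo \<open>\<chi>\<close>. If \<open>n\<close> monomials were linearly dependent modulo
  \<open>\<chi>\<close>, then \<open>\<chi>\<close> would divide a nonzero polynomial with at most \<open>n\<close> terms, which by the rule of
  Descartes has fewer than \<open>n\<close> positive roots, counted with multiplicity. So any \<open>n\<close> distinct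
  monomials form a basis, and a solution that vanishes at \<open>n\<close> indices is zero (\<open>recurrence_zero_bound\<close>).\<close>

section \<open>Positive roots of sparse polynomials\<close>

text \<open>Rolle's theorem between consecutive points of \<open>S\<close>. The points of \<open>Y\<close> avoid \<open>S\<close>, so that
  the zeros of the derivative found here come in addition to those at the multiple roots in \<open>S\<close>.
  That they lie between the extremes of \<open>S\<close> keeps them positive when \<open>S\<close> is, and lets the
  induction place the next one beyond all earlier ones.\<close>
lemma Rolle_points:
  fixes f :: "real poly"
  assumes "finite S" "S \<noteq> {}" "\<And>x. x \<in> S \<Longrightarrow> poly f x = 0"
  shows "\<exists>Y. finite Y \<and> card S = Suc (card Y) \<and> Y \<inter> S = {} \<and> Y \<subseteq> {Min S..Max S}
    \<and> (\<forall>y\<in>Y. poly (pderiv f) y = 0)"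
  using assms
proof (induction S rule: finite_linorder_max_induct)
  case empty
  then show ?case by simp
next
  case (insert b S)
  show ?case
  proof (cases "S = {}")
    case True
    then show ?thesis by (intro exI[of _ "{}"]) auto
  next
    case False
    then obtain Y where Y: "finite Y" "card S = Suc (card Y)" "Y \<inter> S = {}" "Y \<subseteq> {Min S..Max S}"
      "\<forall>y\<in>Y. poly (pderiv f) y = 0" using insert by auto
    have MS: "Max S \<in> S" "Max S < b" using insert False by auto
    obtain y where y: "Max S < y" "y < b" "poly (pderiv f) y = 0"
    proof -
      have "\<exists>y>Max S. y < b \<and> poly f b - poly f (Max S) = (b - Max S) * poly (pderiv f) y"
        using poly_MVT[OF MS(2), of f] .
      then show ?thesis using insert.prems MS that by auto
    qed
    have "\<And>z. z \<in> S \<Longrightarrow> z \<le> Max S" using insert by auto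
    then have yn: "y \<notin> S" using y by force
    have yY: "y \<notin> Y" using Y y by force
    have bY: "b \<notin> Y" using Y(4) MS by auto
    have bS: "b \<notin> S" using insert by auto
    have mn: "Min (insert b S) = Min S" using insert False MS
      by (metis Min_in Min_insert less_imp_le min.absorb2)
    have mx: "Max (insert b S) = b" using insert.hyps(1) False less_imp_le[OF MS(2)] by (simp add: max_absorb1)
    show ?thesis
    proof (intro exI[of _ "insert y Y"] conjI)
      show "insert y Y \<subseteq> {Min (insert b S)..Max (insert b S)}"
        unfolding mn mx using Y(4) y MS Min_le[OF \<open>finite S\<close> MS(1)] by auto
    qed (use Y y yn yY bY bS insert.hyps in auto)
  qed
qed

text \<open>The weak form of the rule of Descartes, counting terms instead of sign changes. A power of
  \<open>x\<close> may be divided out, and once there is a constant term, differentiation removes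
  exactly one term and, by Rolle's theorem, at most one positive root counted with multiplicity.\<close>
lemma Descartes_sparse:
  fixes f :: "real poly"
  assumes "f \<noteq> 0"
  shows "(\<Sum>x | 0 < x \<and> poly f x = 0. Polynomial.order x f) < card {k. coeff f k \<noteq> 0}"
  using assms
proof (induction "degree f" arbitrary: f rule: less_induct)
  case less
  have supp: "{k. coeff f k \<noteq> 0} \<subseteq> {..degree f}" for f :: "real poly" by (auto simp: le_degree)
  then have fin_supp: "finite {k. coeff f k \<noteq> 0}" for f :: "real poly" using finite_subset by blast
  obtain a g where f: "f = pCons a g" by (cases f)
  show ?case
  proof (cases "a = 0")
    case True
    have g: "g \<noteq> 0" using less.prems f True by auto
    have "degree g < degree f" using g f by simp
    then have IH: "(\<Sum>x | 0 < x \<and> poly g x = 0. Polynomial.order x g) < card {k. coeff g k \<noteq> 0}"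
      using less.hyps g by blast
    have fm: "f = [:-0, 1:] * g" using f True by simp
    have "Polynomial.order x f = Polynomial.order x g" if "x > 0" for x
    proof -
      have "Polynomial.order x [:-0, 1:] = 0" using that by (intro order_0I) simp
      then show ?thesis unfolding fm using order_mult[of "[:-0,1:]" g x] g by auto
    qed
    then have e1: "(\<Sum>x | 0 < x \<and> poly f x = 0. Polynomial.order x f) = (\<Sum>x | 0 < x \<and> poly g x = 0. Polynomial.order x g)"
      by (intro sum.cong) (auto simp: fm)
    have "{k. coeff f k \<noteq> 0} = Suc ` {k. coeff g k \<noteq> 0}"
    proof -
      have "k \<in> Suc ` {k. coeff g k \<noteq> 0}" if "coeff f k \<noteq> 0" for k
        using that f True by (cases k) auto
      then show ?thesis using f by auto
    qed
    then have "card {k. coeff f k \<noteq> 0} = card {k. coeff g k \<noteq> 0}" by (simp add: card_image)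
    then show ?thesis using IH e1 by simp
  next
    case False
    have f0: "coeff f 0 \<noteq> 0" using f False by simp
    define S where "S = {x. 0 < x \<and> poly f x = 0}"
    have finS: "finite S" unfolding S_def using poly_roots_finite[OF less.prems] by (rule rev_finite_subset) auto
    show ?thesis
    proof (cases "S = {}")
      case True
      have "0 < card {k. coeff f k \<noteq> 0}" using f0 fin_supp[of f] card_gt_0_iff by blast
      then show ?thesis unfolding S_def[symmetric] True by simp
    next
      case ne: False
      define d where "d = pderiv f"
      have deg: "degree f > 0"
      proof (rule ccontr)
        assume "\<not> degree f > 0"
        then obtain c where "f = [:c:]" using degree_eq_zeroE by auto
        then show False using ne f0 unfolding S_def by auto
      qed
      have d0: "d \<noteq> 0" using deg unfolding d_def pderiv_eq_0_iff by simp
      have dd: "degree d < degree f" using deg unfolding d_def degree_pderiv by simp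
      have IH: "(\<Sum>x | 0 < x \<and> poly d x = 0. Polynomial.order x d) < card {k. coeff d k \<noteq> 0}"
        using less.hyps dd d0 by blast
      have supp_d: "{k. coeff f k \<noteq> 0} = insert 0 (Suc ` {k. coeff d k \<noteq> 0})"
      proof -
        have "k \<in> Suc ` {k. coeff d k \<noteq> 0}" if "coeff f k \<noteq> 0" "k \<noteq> 0" for k
          using that by (cases k) (auto simp: d_def coeff_pderiv)
        then show ?thesis using f0 by (auto simp: d_def coeff_pderiv)
      qed
      have card_d: "card {k. coeff f k \<noteq> 0} = Suc (card {k. coeff d k \<noteq> 0})"
        unfolding supp_d using fin_supp[of d] by (simp add: card_image)
      obtain Y where Y: "finite Y" "card S = Suc (card Y)" "Y \<inter> S = {}" "Y \<subseteq> {Min S..Max S}"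
        "\<forall>y\<in>Y. poly d y = 0"
        using Rolle_points[OF finS ne, of f] unfolding S_def d_def by auto
      have "Min S > 0" using Min_in[OF finS ne] unfolding S_def by auto
      then have Ypos: "\<And>y. y \<in> Y \<Longrightarrow> y > 0" using Y(4) by force
      have ordS: "Polynomial.order x f = Suc (Polynomial.order x d)" if "x \<in> S" for x
        unfolding d_def using that d0 less.prems
        by (intro order_pderiv) (auto simp: S_def d_def order_root)
      have ordY: "1 \<le> Polynomial.order y d" if "y \<in> Y" for y
        using Y(5) that d0 order_root[of d y] by simp
      let ?D = "{x. 0 < x \<and> poly d x = 0}"
      have finD: "finite ?D" using poly_roots_finite[OF d0] by (rule rev_finite_subset) auto
      have "(\<Sum>x\<in>S. Polynomial.order x f) = (\<Sum>x\<in>S. Polynomial.order x d) + card S"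
        by (simp add: ordS sum_Suc)
      also have "\<dots> = (\<Sum>x\<in>S. Polynomial.order x d) + card Y + 1" using Y(2) by simp
      also have "\<dots> \<le> (\<Sum>x\<in>S. Polynomial.order x d) + (\<Sum>x\<in>Y. Polynomial.order x d) + 1"
        using sum_mono[of Y "\<lambda>_. 1" "\<lambda>x. Polynomial.order x d"] ordY by simp
      also have "\<dots> = (\<Sum>x\<in>S \<union> Y. Polynomial.order x d) + 1"
        using Y(1,3) finS by (subst sum.union_disjoint) auto
      also have "(\<Sum>x\<in>S \<union> Y. Polynomial.order x d) = (\<Sum>x\<in>(S \<union> Y) \<inter> ?D. Polynomial.order x d)"
        by (rule sum.mono_neutral_right)
          (use Y(1) finS Ypos d0 in \<open>auto simp: S_def order_root[of d]\<close>)
      also have "\<dots> \<le> (\<Sum>x\<in>?D. Polynomial.order x d)"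
        by (rule sum_mono2[OF finD]) auto
      finally show ?thesis using IH card_d unfolding S_def by simp
    qed
  qed
qed

section \<open>Zeros of solutions of linear recurrences\<close>

text \<open>The linear functional on polynomials that sends \<open>x\<^sup>k\<close> to \<open>s k\<close>. Multiplying its argument by
  \<open>x\<close> amounts to shifting \<open>s\<close>, so \<open>s\<close> satisfies the recurrence with characteristic polynomial \<open>q\<close>
  precisely when the functional vanishes on all multiples of \<open>q\<close>.\<close>
definition moment :: "(nat \<Rightarrow> real) \<Rightarrow> real poly \<Rightarrow> real" where
  "moment s p = (\<Sum>i\<le>degree p. coeff p i * s i)"

lemma moment_le: "degree p \<le> N \<Longrightarrow> moment s p = (\<Sum>i\<le>N. coeff p i * s i)"
  unfolding moment_def by (rule sum.mono_neutral_left) (auto simp: coeff_eq_0)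

lemma moment_0 [simp]: "moment s 0 = 0"
  by (simp add: moment_def)

lemma moment_add: "moment s (p + q) = moment s p + moment s q"
proof -
  let ?N = "max (degree p) (degree q)"
  have "degree (p + q) \<le> ?N" by (rule degree_add_le_max)
  then show ?thesis
    by (simp add: moment_le[of _ ?N] sum.distrib algebra_simps)
qed

lemma moment_smult: "moment s (Polynomial.smult a p) = a * moment s p"
  by (simp add: moment_le[of _ "degree p"] sum_distrib_left algebra_simps)

lemma moment_sum: "moment s (\<Sum>i\<in>I. f i) = (\<Sum>i\<in>I. moment s (f i))"
  by (induction I rule: infinite_finite_induct) (auto simp: moment_add)

lemma moment_monom: "moment s (monom a k) = a * s k"
proof -
  have "moment s (monom a k) = (\<Sum>i\<le>k. coeff (monom a k) i * s i)"
    by (rule moment_le) (rule degree_monom_le)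
  also have "\<dots> = (\<Sum>i\<in>{k}. coeff (monom a k) i * s i)"
    by (rule sum.mono_neutral_right) auto
  finally show ?thesis by simp
qed

lemma moment_X: "moment s (pCons 0 p) = moment (\<lambda>k. s (Suc k)) p"
proof -
  have "moment s (pCons 0 p) = (\<Sum>i\<le>Suc (degree p). coeff (pCons 0 p) i * s i)"
    by (rule moment_le) (rule degree_pCons_le)
  also have "\<dots> = (\<Sum>i\<le>degree p. coeff p i * s (Suc i))"
    by (subst sum.atMost_Suc_shift) simp
  finally show ?thesis by (simp add: moment_def)
qed

lemma moment_sequence_sum:
  "moment (\<lambda>k. \<Sum>i\<in>I. a i * s i k) p = (\<Sum>i\<in>I. a i * moment (s i) p)"
  by (simp add: moment_def sum_distrib_left) (subst sum.swap, simp add: ac_simps)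

text \<open>The theorem of Cayley and Hamilton for the coordinates of the iterates of a row vector under
  \<open>F\<close>. Let \<open>C = x I - F\<close>. The iteration rule says that the row of functionals of the
  coordinates annihilates each column of \<open>C\<close>, even after multiplication by any polynomial. It
  therefore annihilates \<open>C\<close> times its adjugate, which is the characteristic polynomial times the
  identity.\<close>
lemma moment_char_poly_eq_0:
  fixes F :: "real mat" and y :: "nat \<Rightarrow> nat \<Rightarrow> real"
  assumes F: "F \<in> carrier_mat n n"
    and step: "\<And>k m. m < n \<Longrightarrow> y (Suc k) m = (\<Sum>i<n. F $$ (i, m) * y k i)"
    and l: "l < n"
  shows "moment (\<lambda>k. y k l) (char_poly F * p) = 0"
proof -
  define C where "C = char_poly_matrix F"
  have C: "C \<in> carrier_mat n n" unfolding C_def using F by simp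
  define B where "B = adj_mat C"
  have B: "B \<in> carrier_mat n n" unfolding B_def using adj_mat(1)[OF C] .
  have Cm: "C $$ (i, m) * q = (if i = m then pCons 0 q else 0) + Polynomial.smult (- (F $$ (i, m))) q"
    if "i < n" "m < n" for i m and q :: "real poly"
    using that F unfolding C_def char_poly_matrix_def by (auto simp: algebra_simps)
  have relation: "(\<Sum>i<n. moment (\<lambda>k. y k i) (C $$ (i, m) * q)) = 0" if m: "m < n" for m q
  proof -
    have "(\<Sum>i<n. moment (\<lambda>k. y k i) (C $$ (i, m) * q))
        = (\<Sum>i<n. (if i = m then moment (\<lambda>k. y k m) (pCons 0 q) else 0)
            - F $$ (i, m) * moment (\<lambda>k. y k i) q)"
      by (rule sum.cong) (auto simp: Cm m moment_add moment_smult simp del: smult_minus_left)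
    also have "\<dots> = moment (\<lambda>k. y (Suc k) m) q - (\<Sum>i<n. F $$ (i, m) * moment (\<lambda>k. y k i) q)"
      using m by (simp add: sum_subtractf moment_X)
    also have "\<dots> = 0"
      by (simp add: step[OF m] moment_sequence_sum)
    finally show ?thesis .
  qed
  have CB: "(\<Sum>m<n. C $$ (i, m) * B $$ (m, l)) = (if i = l then char_poly F else 0)"
    if i: "i < n" for i
  proof -
    have "(C * B) $$ (i, l) = (\<Sum>m<n. C $$ (i, m) * B $$ (m, l))"
      using i l C B by (simp add: times_mat_def scalar_prod_def lessThan_atLeast0)
    moreover have "C * B = Determinant.det C \<cdot>\<^sub>m 1\<^sub>m n" unfolding B_def using adj_mat(2)[OF C] .
    ultimately show ?thesis using i l by (cases "i = l") (simp_all add: char_poly_def C_def)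
  qed
  have "moment (\<lambda>k. y k l) (char_poly F * p)
      = (\<Sum>i<n. moment (\<lambda>k. y k i) ((if i = l then char_poly F else 0) * p))"
    using l by (simp add: if_distrib[of "\<lambda>q. moment _ (q * p)"] cong: if_cong)
  also have "\<dots> = (\<Sum>i<n. moment (\<lambda>k. y k i) ((\<Sum>m<n. C $$ (i, m) * B $$ (m, l)) * p))"
    by (rule sum.cong) (simp_all add: CB)
  also have "\<dots> = (\<Sum>i<n. \<Sum>m<n. moment (\<lambda>k. y k i) (C $$ (i, m) * (B $$ (m, l) * p)))"
    by (simp add: sum_distrib_right moment_sum mult.assoc)
  also have "\<dots> = (\<Sum>m<n. \<Sum>i<n. moment (\<lambda>k. y k i) (C $$ (i, m) * (B $$ (m, l) * p)))"
    by (rule sum.swap)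
  also have "\<dots> = 0" by (simp add: relation)
  finally show ?thesis .
qed

text \<open>As \<open>s k\<close> depends on \<open>x\<^sup>k\<close> modulo \<open>q\<close> only, the values of \<open>s\<close> on \<open>Z\<close> are the images of the
  initial values \<open>s 0, ..., s (n - 1)\<close> under a square matrix. A vector in the kernel of its
  transpose is a polynomial supported on \<open>Z\<close> and divisible by \<open>q\<close>, which the rule of Descartes
  excludes; so the initial values vanish, and with them all of \<open>s\<close>.\<close>
lemma recurrence_zero_bound:
  fixes s :: "nat \<Rightarrow> real" and q :: "real poly"
  assumes q: "q \<noteq> 0"
    and roots: "degree q \<le> (\<Sum>x | 0 < x \<and> poly q x = 0. Polynomial.order x q)"
    and ann: "\<And>p. moment s (q * p) = 0"
    and Z: "finite Z" "card Z = degree q" "\<And>k. k \<in> Z \<Longrightarrow> s k = 0"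
  shows "s k = 0"
proof -
  define n where "n = degree q"
  have s_mod: "s k = (\<Sum>j<n. coeff (monom 1 k mod q) j * s j)" for k
  proof -
    have "s k = moment s (monom 1 k)" by (simp add: moment_monom)
    also have "\<dots> = moment s (q * (monom 1 k div q) + monom 1 k mod q)" by simp
    also have "\<dots> = moment s (monom 1 k mod q)" unfolding moment_add ann by simp
    also have "\<dots> = (\<Sum>j<n. coeff (monom 1 k mod q) j * s j)"
    proof (cases "monom 1 k mod q = 0")
      case False
      then have "degree (monom 1 k mod q) < n" using degree_mod_less[OF q] n_def by auto
      then show ?thesis unfolding moment_def
        by (intro sum.mono_neutral_left) (auto simp: coeff_eq_0)
    qed simp
    finally show ?thesis .
  qed
  obtain e where e: "bij_betw e {..<n} Z"
    using ex_bij_betw_nat_finite[OF Z(1)] Z(2) n_def by (auto simp: lessThan_atLeast0)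
  \<comment> \<open>Row \<open>i\<close> holds the coordinates of \<open>x\<close> to the power \<open>e i\<close> modulo \<open>q\<close>.\<close>
  define N where "N = Matrix.mat n n (\<lambda>(i, j). coeff (monom 1 (e i) mod q) j)"
  have N: "N \<in> carrier_mat n n" unfolding N_def by simp
  have "Determinant.det N \<noteq> 0"
  proof
    assume "Determinant.det N = 0"
    then have "Determinant.det (transpose_mat N) = 0" using det_transpose[OF N] by simp
    then obtain v where v: "v \<in> carrier_vec n" "v \<noteq> 0\<^sub>v n" "transpose_mat N *\<^sub>v v = 0\<^sub>v n"
      using det_0_iff_vec_prod_zero[of "transpose_mat N" n] N by auto
    \<comment> \<open>The linear dependency of the rows of \<open>N\<close>, read as a polynomial supported on \<open>Z\<close>.\<close>
    define f where "f = (\<Sum>i<n. monom (vec_index v i) (e i))"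
    have mod_sum: "(\<Sum>i<m. g i) mod q = (\<Sum>i<m. g i mod q)" for m :: nat and g :: "nat \<Rightarrow> real poly"
      by (induction m) (auto simp: poly_mod_add_left)
    have mm: "monom (vec_index v i) (e i) mod q = Polynomial.smult (vec_index v i) (monom 1 (e i) mod q)" for i
      by (simp add: mod_smult_left[symmetric] smult_monom)
    have "coeff (f mod q) j = 0" for j
    proof (cases "j < n")
      case True
      have "coeff (f mod q) j = (\<Sum>i<n. vec_index v i * coeff (monom 1 (e i) mod q) j)"
        unfolding f_def mod_sum by (simp add: coeff_sum mm)
      also have "\<dots> = vec_index (transpose_mat N *\<^sub>v v) j"
        using True v(1) by (simp add: N_def scalar_prod_def lessThan_atLeast0 ac_simps)
      finally show ?thesis using v(3) True by simp
    next
      case False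
      then show ?thesis using degree_mod_less[OF q, of f] n_def by (cases "f mod q = 0") (auto simp: coeff_eq_0)
    qed
    then have "f mod q = 0" by (intro poly_eqI) simp
    then have qf: "q dvd f" by (rule mod_0_imp_dvd)
    have cf: "coeff f (e i) = vec_index v i" if "i < n" for i
    proof -
      have "coeff f (e i) = (\<Sum>j<n. if j = i then vec_index v j else 0)"
        unfolding f_def coeff_sum
        using that e by (intro sum.cong) (auto simp: bij_betw_def inj_on_def)
      then show ?thesis using that by simp
    qed
    have "f \<noteq> 0"
    proof
      assume "f = 0"
      then have "\<And>i. i < n \<Longrightarrow> vec_index v i = 0" using cf by simp
      then show False using v(1,2) by (metis carrier_vecD eq_vecI index_zero_vec)
    qed
    have "{k. coeff f k \<noteq> 0} \<subseteq> Z"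
    proof
      fix k assume "k \<in> {k. coeff f k \<noteq> 0}"
      then have "(\<Sum>i<n. coeff (monom (vec_index v i) (e i)) k) \<noteq> 0" unfolding f_def coeff_sum by simp
      then obtain i where "i < n" "coeff (monom (vec_index v i) (e i)) k \<noteq> 0"
        by (metis (no_types, lifting) lessThan_iff sum.neutral)
      then show "k \<in> Z" using e by (auto simp: bij_betw_def split: if_splits)
    qed
    then have "card {k. coeff f k \<noteq> 0} \<le> n" using card_mono[OF Z(1)] Z(2) n_def by metis
    moreover have "n \<le> (\<Sum>x | 0 < x \<and> poly f x = 0. Polynomial.order x f)"
    proof -
      have "n \<le> (\<Sum>x | 0 < x \<and> poly q x = 0. Polynomial.order x q)" using roots n_def by simp
      also have "\<dots> \<le> (\<Sum>x | 0 < x \<and> poly q x = 0. Polynomial.order x f)"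
        using dvd_imp_order_le[OF \<open>f \<noteq> 0\<close> qf] by (rule sum_mono)
      also have "\<dots> \<le> (\<Sum>x | 0 < x \<and> poly f x = 0. Polynomial.order x f)"
        using qf by (intro sum_mono2 finite_subset[OF _ poly_roots_finite[OF \<open>f \<noteq> 0\<close>]]) (auto elim: dvdE)
      finally show ?thesis .
    qed
    ultimately show False using Descartes_sparse[OF \<open>f \<noteq> 0\<close>] by simp
  qed
  moreover have "N *\<^sub>v Matrix.vec n s = 0\<^sub>v n"
  proof (rule eq_vecI)
    fix i assume "i < dim_vec (0\<^sub>v n :: real Matrix.vec)"
    then have i: "i < n" by simp
    then have "e i \<in> Z" using e by (auto simp: bij_betw_def)
    have "vec_index (N *\<^sub>v Matrix.vec n s) i = (\<Sum>j<n. coeff (monom 1 (e i) mod q) j * s j)"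
      using i by (simp add: N_def scalar_prod_def lessThan_atLeast0)
    also have "\<dots> = s (e i)" by (rule s_mod[symmetric])
    finally show "vec_index (N *\<^sub>v Matrix.vec n s) i = vec_index (0\<^sub>v n) i" using Z(3)[OF \<open>e i \<in> Z\<close>] i by simp
  qed (simp add: N_def)
  ultimately have "Matrix.vec n s = 0\<^sub>v n"
    using det_0_iff_vec_prod_zero[OF N] by (metis vec_carrier)
  then have "s j = 0" if "j < n" for j using that by (metis index_vec index_zero_vec(1))
  then show ?thesis using s_mod[of k] by simp
qed

section \<open>Resolvents and impulse responses\<close>

text \<open>In the variable \<open>w = 1 / z\<close> the difference of the two expansions is a power series that
  vanishes near \<open>0\<close>, and zeros of a nonzero power series are isolated.\<close>
lemma impulse_response_unique:
  assumes "impulse_response H t" "impulse_response H t'"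
  shows "t (Suc k) = t' (Suc k)"
proof (rule ccontr)
  assume ne: "t (Suc k) \<noteq> t' (Suc k)"
  define d where "d k = complex_of_real (t (Suc k)) - complex_of_real (t' (Suc k))" for k
  have "\<forall>\<^sub>F z in at_infinity. (\<lambda>k. d k / z ^ Suc k) sums 0"
    using assms unfolding impulse_response_def
  proof eventually_elim
    case (elim z)
    from sums_diff[OF this] show ?case by (simp add: d_def diff_divide_distrib)
  qed
  then obtain b where b: "\<And>z. b \<le> norm z \<Longrightarrow> (\<lambda>k. d k / z ^ Suc k) sums 0"
    unfolding eventually_at_infinity by blast
  \<comment> \<open>The coefficient at 0 is set to 0, as the expansion at infinity has no constant term.\<close>
  define a where "a n = (case n of 0 \<Rightarrow> 0 | Suc j \<Rightarrow> d j)" for n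
  define r where "r = 1 / max b 1"
  have r: "0 < r" unfolding r_def by simp
  have sm: "(\<lambda>n. a n * (w - 0) ^ n) sums (\<lambda>_. 0) w" if w: "norm (w - 0) < r" for w :: complex
  proof (cases "w = 0")
    case True
    then show ?thesis using powser_sums_zero[of a] by (simp add: a_def)
  next
    case False
    have "norm w * max b 1 < 1" using w unfolding r_def by (simp add: pos_less_divide_eq)
    then have "max b 1 \<le> norm (1 / w)" using False by (simp add: norm_divide pos_le_divide_eq mult.commute del: max.bounded_iff)
    then have "(\<lambda>k. d k / (1 / w) ^ Suc k) sums 0" by (intro b) simp
    then have "(\<lambda>k. a (Suc k) * w ^ Suc k) sums 0" by (simp add: a_def power_divide)
    then show ?thesis by (subst (asm) sums_Suc_iff) (simp add: a_def)
  qed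
  have "a (Suc k) \<noteq> 0" using ne by (simp add: a_def d_def)
  then obtain s where "0 < s" "\<And>z::complex. z \<in> cball 0 s - {0} \<Longrightarrow> (0::complex) \<noteq> 0"
    using powser_0_nonzero[OF r sm, of "Suc k"] by blast
  from this(2)[of "of_real s"] this(1) show False by simp
qed

lemma mult_mat_vec_funpow_carrier:
  assumes "F \<in> carrier_mat n n" "g \<in> carrier_vec n"
  shows "((*\<^sub>v) F ^^ k) g \<in> carrier_vec n"
  using assms by (induction k) auto

lemma mult_mat_vec_index:
  assumes "F \<in> carrier_mat n m" "x \<in> carrier_vec m" "i < n"
  shows "vec_index (F *\<^sub>v x) i = (\<Sum>j<m. F $$ (i, j) * vec_index x j)"
  using assms by (simp add: scalar_prod_def lessThan_atLeast0)

text \<open>Cramer's rule for the resolvent. Evaluating the adjugate of the matrix of polynomials \<open>x I - F\<close> at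
  \<open>z\<close> exhibits the entries of \<open>\<chi>(z) (z I - F)\<^sup>-\<^sup>1\<close> as polynomials in \<open>z\<close>.\<close>
lemma mat_inverse_resolvent:
  fixes F :: "complex mat"
  assumes F: "F \<in> carrier_mat n n" and z: "poly (char_poly F) z \<noteq> 0"
  obtains R where "mat_inverse (z \<cdot>\<^sub>m 1\<^sub>m n - F) = Some R" "R \<in> carrier_mat n n"
    "(z \<cdot>\<^sub>m 1\<^sub>m n - F) * R = 1\<^sub>m n" "R * (z \<cdot>\<^sub>m 1\<^sub>m n - F) = 1\<^sub>m n"
    "map_mat (\<lambda>p. poly p z) (adj_mat (char_poly_matrix F)) = poly (char_poly F) z \<cdot>\<^sub>m R"
proof -
  define C where "C = char_poly_matrix F"
  have C: "C \<in> carrier_mat n n" unfolding C_def using F by simp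
  define Cz where "Cz = z \<cdot>\<^sub>m 1\<^sub>m n - F"
  have Cz: "Cz \<in> carrier_mat n n" unfolding Cz_def using F by auto
  have ev: "map_mat (\<lambda>p. poly p z) C = Cz"
    unfolding C_def Cz_def char_poly_matrix_def using F by (intro eq_matI) auto
  have det: "Determinant.det Cz = poly (char_poly F) z"
    unfolding ev[symmetric] comm_ring_hom.hom_det[OF poly_hom.comm_ring_hom_axioms]
    by (simp add: char_poly_def C_def)
  have unit: "Cz \<in> Units (ring_mat TYPE(complex) n ())"
    using det_non_zero_imp_unit[OF Cz] det z by simp
  obtain R where R: "mat_inverse Cz = Some R"
    using mat_inverse(1)[OF Cz, where b = "()"] unit by (cases "mat_inverse Cz") auto
  from mat_inverse(2)[OF Cz this] have R': "Cz * R = 1\<^sub>m n" "R * Cz = 1\<^sub>m n" "R \<in> carrier_mat n n" by auto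
  define E where "E = map_mat (\<lambda>p. poly p z) (adj_mat C)"
  have E: "E \<in> carrier_mat n n" unfolding E_def using adj_mat(1)[OF C] by simp
  have "E * Cz = map_mat (\<lambda>p. poly p z) (adj_mat C * C)"
    unfolding ev[symmetric] E_def by (rule semiring_hom.mat_hom_mult[OF poly_hom.semiring_hom_axioms adj_mat(1)[OF C] C, symmetric])
  also have "\<dots> = poly (char_poly F) z \<cdot>\<^sub>m 1\<^sub>m n"
    unfolding adj_mat(3)[OF C] by (intro eq_matI) (auto simp: char_poly_def C_def)
  finally have EC: "E * Cz = poly (char_poly F) z \<cdot>\<^sub>m 1\<^sub>m n" .
  have "E = E * (Cz * R)" using R' E by simp
  also have "\<dots> = (E * Cz) * R" using E Cz R' by simp
  also have "\<dots> = poly (char_poly F) z \<cdot>\<^sub>m R"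
    unfolding EC using R'(3) by (simp add: mult_smult_assoc_mat[of _ n n _ n])
  finally show ?thesis using that R R' unfolding Cz_def E_def C_def by blast
qed

lemma char_poly_of_real:
  assumes "F \<in> carrier_mat n n"
  shows "char_poly (map_mat complex_of_real F) = map_poly complex_of_real (char_poly F)"
  by (rule of_real_hom.char_poly_hom[OF assms])

lemma realization_numerator:
  assumes "realization H n h F g"
  obtains p where "\<And>z. poly (map_poly complex_of_real (char_poly F)) z \<noteq> 0 \<Longrightarrow>
    poly (map_poly complex_of_real (char_poly F)) z * H z = poly p z"
proof -
  have car: "h \<in> carrier_vec n" "F \<in> carrier_mat n n" "g \<in> carrier_vec n"
    and Hz: "\<And>z R. mat_inverse (z \<cdot>\<^sub>m 1\<^sub>m n - map_mat complex_of_real F) = Some R \<Longrightarrow>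
        H z = scalar_prod (map_vec complex_of_real h) (R *\<^sub>v map_vec complex_of_real g)"
    using assms unfolding realization_def by auto
  define Fc where "Fc = map_mat complex_of_real F"
  have Fc: "Fc \<in> carrier_mat n n" unfolding Fc_def using car by simp
  define B where "B = adj_mat (char_poly_matrix Fc)"
  define p where "p = (\<Sum>i<n. \<Sum>j<n. Polynomial.smult
      (complex_of_real (vec_index h i) * complex_of_real (vec_index g j)) (B $$ (i, j)))"
  have B: "B \<in> carrier_mat n n" unfolding B_def using adj_mat(1)[of "char_poly_matrix Fc" n] Fc by simp
  show ?thesis
  proof (rule that[of p])
    fix z assume "poly (map_poly complex_of_real (char_poly F)) z \<noteq> 0"
    then have z: "poly (char_poly Fc) z \<noteq> 0" unfolding Fc_def char_poly_of_real[OF car(2)] .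
    obtain R where R: "mat_inverse (z \<cdot>\<^sub>m 1\<^sub>m n - Fc) = Some R" "R \<in> carrier_mat n n"
      "map_mat (\<lambda>p. poly p z) B = poly (char_poly Fc) z \<cdot>\<^sub>m R"
      using mat_inverse_resolvent[OF Fc z] unfolding B_def by metis
    have entry: "poly (B $$ (i, j)) z = poly (char_poly Fc) z * R $$ (i, j)" if "i < n" "j < n" for i j
      using arg_cong[OF R(3), of "\<lambda>N. N $$ (i, j)"] that B R(2) by simp
    have "H z = (\<Sum>i<n. complex_of_real (vec_index h i) * (\<Sum>j<n. R $$ (i, j) * complex_of_real (vec_index g j)))"
      using Hz[OF R(1)[unfolded Fc_def]] car R(2)
      by (simp add: scalar_prod_def lessThan_atLeast0)
    then have "poly (char_poly Fc) z * H z = poly p z"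
      by (simp add: p_def poly_sum entry sum_distrib_left ac_simps)
    then show "poly (map_poly complex_of_real (char_poly F)) z * H z = poly p z"
      unfolding Fc_def char_poly_of_real[OF car(2)] .
  qed
qed

text \<open>The Neumann series. For large \<open>\<bar>z\<bar>\<close> the vector \<open>v = \<Sum>\<^sub>k F\<^sup>k g / z\<^bsup>k+1\<^esup>\<close> converges
  coordinatewise and solves \<open>(z I - F) v = g\<close>, so it is the resolvent applied to \<open>g\<close>. The exponent
  \<open>k - 1\<close> reflects that impulse responses are indexed from 1.\<close>
lemma realization_impulse_response:
  assumes "realization H n h F g"
  shows "impulse_response H (\<lambda>k. scalar_prod h (((*\<^sub>v) F ^^ (k - 1)) g))"
proof -
  have car: "h \<in> carrier_vec n" "F \<in> carrier_mat n n" "g \<in> carrier_vec n"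
    and Hz: "\<And>z R. mat_inverse (z \<cdot>\<^sub>m 1\<^sub>m n - map_mat complex_of_real F) = Some R \<Longrightarrow>
        H z = scalar_prod (map_vec complex_of_real h) (R *\<^sub>v map_vec complex_of_real g)"
    using assms unfolding realization_def by auto
  define Fc where "Fc = map_mat complex_of_real F"
  have Fc: "Fc \<in> carrier_mat n n" unfolding Fc_def using car by simp
  define x where "x k = ((*\<^sub>v) F ^^ k) g" for k
  have x: "x k \<in> carrier_vec n" for k unfolding x_def using mult_mat_vec_funpow_carrier[OF car(2,3)] .
  have x_Suc: "vec_index (x (Suc k)) i = (\<Sum>j<n. F $$ (i, j) * vec_index (x k) j)" if "i < n" for k i
    using mult_mat_vec_index[OF car(2) x[of k] that] by (simp add: x_def)
  \<comment> \<open>A crude operator norm: the iterates grow at most like \<open>B\<^sup>k\<close>.\<close>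
  define B where "B = (\<Sum>i<n. \<Sum>j<n. \<bar>F $$ (i, j)\<bar>)"
  define G where "G = (\<Sum>i<n. \<bar>vec_index g i\<bar>)"
  have B0: "0 \<le> B" unfolding B_def by (simp add: sum_nonneg)
  have G0: "0 \<le> G" unfolding G_def by (simp add: sum_nonneg)
  have bound: "\<bar>vec_index (x k) i\<bar> \<le> G * B ^ k" if "i < n" for k i
    using that
  proof (induction k arbitrary: i)
    case 0
    have "\<bar>vec_index g i\<bar> \<le> G" unfolding G_def using 0 by (intro member_le_sum) auto
    then show ?case by (simp add: x_def)
  next
    case (Suc k)
    have "\<bar>vec_index (x (Suc k)) i\<bar> \<le> (\<Sum>j<n. \<bar>F $$ (i, j) * vec_index (x k) j\<bar>)"
      unfolding x_Suc[OF Suc.prems] by (rule sum_abs)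
    also have "\<dots> \<le> (\<Sum>j<n. \<bar>F $$ (i, j)\<bar> * (G * B ^ k))"
      by (intro sum_mono) (auto simp: abs_mult intro!: mult_left_mono Suc.IH)
    also have "\<dots> = (\<Sum>j<n. \<bar>F $$ (i, j)\<bar>) * (G * B ^ k)" by (simp add: sum_distrib_right)
    also have "\<dots> \<le> B * (G * B ^ k)"
    proof (rule mult_right_mono)
      show "(\<Sum>j<n. \<bar>F $$ (i, j)\<bar>) \<le> B" unfolding B_def
        using Suc.prems by (intro member_le_sum[of i "{..<n}" "\<lambda>i. \<Sum>j<n. \<bar>F $$ (i, j)\<bar>"]) (auto simp: sum_nonneg)
    qed (use B0 G0 in simp)
    finally show ?case by (simp add: ac_simps)
  qed
  have "char_poly Fc \<noteq> 0" using degree_monic_char_poly[OF Fc] by auto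
  then have "finite {z. poly (char_poly Fc) z = 0}" by (rule poly_roots_finite)
  then obtain b where b: "\<And>z. poly (char_poly Fc) z = 0 \<Longrightarrow> norm z \<le> b"
    by (metis (mono_tags, lifting) bounded_iff finite_imp_bounded mem_Collect_eq)
  have main: "(\<lambda>k. complex_of_real (scalar_prod h (x k)) / z ^ Suc k) sums H z"
    if zb: "norm z > max B b" for z
  proof -
    have z0: "z \<noteq> 0" using zb B0 by auto
    have "poly (char_poly Fc) z \<noteq> 0" using b[of z] zb by auto
    then obtain R where R: "mat_inverse (z \<cdot>\<^sub>m 1\<^sub>m n - Fc) = Some R" "R \<in> carrier_mat n n"
      "R * (z \<cdot>\<^sub>m 1\<^sub>m n - Fc) = 1\<^sub>m n"
      using mat_inverse_resolvent[OF Fc] by metis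
    define v where "v i = (\<Sum>k. complex_of_real (vec_index (x k) i) / z ^ Suc k)" for i
    have v: "(\<lambda>k. complex_of_real (vec_index (x k) i) / z ^ Suc k) sums v i" if i: "i < n" for i
    proof -
      have term_bound: "norm (complex_of_real (vec_index (x k) i) / z ^ Suc k) \<le> (G / norm z) * (B / norm z) ^ k" for k
      proof -
        have "norm (complex_of_real (vec_index (x k) i) / z ^ Suc k) = \<bar>vec_index (x k) i\<bar> / norm z ^ Suc k"
          by (simp only: norm_divide norm_power norm_of_real)
        also have "\<dots> \<le> (G * B ^ k) / norm z ^ Suc k"
          by (rule divide_right_mono[OF bound[OF i]]) simp
        finally show ?thesis by (simp add: power_divide)
      qed
      have "norm (B / norm z) < 1" using zb B0 z0 by simp
      then have "summable (\<lambda>k. (G / norm z) * (B / norm z) ^ k)"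
        by (intro summable_mult summable_geometric)
      then have "summable (\<lambda>k. complex_of_real (vec_index (x k) i) / z ^ Suc k)"
        using term_bound by (rule summable_comparison_test')
      then show ?thesis unfolding v_def by (rule summable_sums)
    qed
    have step: "(\<Sum>j<n. complex_of_real (F $$ (i, j)) * v j) = z * v i - complex_of_real (vec_index g i)"
      if i: "i < n" for i
    proof (rule sums_unique2)
      show "(\<lambda>k. complex_of_real (vec_index (x (Suc k)) i) / z ^ Suc k) sums
          (\<Sum>j<n. complex_of_real (F $$ (i, j)) * v j)"
      proof -
        have "(\<lambda>k. \<Sum>j<n. complex_of_real (F $$ (i, j)) * (complex_of_real (vec_index (x k) j) / z ^ Suc k)) sums
          (\<Sum>j<n. complex_of_real (F $$ (i, j)) * v j)"
          by (intro sums_sum sums_mult v) auto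
        then show ?thesis by (simp add: x_Suc[OF i] sum_divide_distrib)
      qed
      have "(\<lambda>k. complex_of_real (vec_index (x k) i) / z ^ k) sums (z * v i)"
        using sums_mult[OF v[OF i], of z] z0 by (simp only: power_Suc times_divide_eq_right nonzero_mult_divide_mult_cancel_left not_False_eq_True)
      then show "(\<lambda>k. complex_of_real (vec_index (x (Suc k)) i) / z ^ Suc k) sums
          (z * v i - complex_of_real (vec_index g i))"
        by (subst sums_Suc_iff) (simp add: x_def)
    qed
    \<comment> \<open>Shifting the series by one index is multiplication by \<open>F\<close>, so \<open>step\<close> is the equation \<open>(z I - F) v = g\<close>.\<close>
    have gv: "map_vec complex_of_real g = (z \<cdot>\<^sub>m 1\<^sub>m n - Fc) *\<^sub>v Matrix.vec n v"
    proof (rule eq_vecI)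
      fix i assume "i < dim_vec ((z \<cdot>\<^sub>m 1\<^sub>m n - Fc) *\<^sub>v Matrix.vec n v)"
      then have i: "i < n" using Fc by simp
      have "vec_index ((z \<cdot>\<^sub>m 1\<^sub>m n - Fc) *\<^sub>v Matrix.vec n v) i
          = (\<Sum>j<n. (z \<cdot>\<^sub>m 1\<^sub>m n - Fc) $$ (i, j) * vec_index (Matrix.vec n v) j)"
        using Fc i by (intro mult_mat_vec_index) auto
      also have "\<dots> = (\<Sum>j<n. (if i = j then z * v j else 0) - complex_of_real (F $$ (i, j)) * v j)"
        using i car(2) by (intro sum.cong) (auto simp: Fc_def algebra_simps)
      also have "\<dots> = complex_of_real (vec_index g i)" using i by (simp add: sum_subtractf step)
      finally show "vec_index (map_vec complex_of_real g) i
          = vec_index ((z \<cdot>\<^sub>m 1\<^sub>m n - Fc) *\<^sub>v Matrix.vec n v) i" using i car(3) by simp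
    qed (use Fc car in simp)
    have "R *\<^sub>v map_vec complex_of_real g = (R * (z \<cdot>\<^sub>m 1\<^sub>m n - Fc)) *\<^sub>v Matrix.vec n v"
      unfolding gv using R(2) Fc by (subst assoc_mult_mat_vec) auto
    then have "R *\<^sub>v map_vec complex_of_real g = Matrix.vec n v" unfolding R(3) by simp
    then have "H z = (\<Sum>i<n. complex_of_real (vec_index h i) * v i)"
      using Hz[OF R(1)[unfolded Fc_def]] car by (simp add: scalar_prod_def lessThan_atLeast0)
    moreover have "(\<lambda>k. \<Sum>i<n. complex_of_real (vec_index h i) * (complex_of_real (vec_index (x k) i) / z ^ Suc k))
        sums (\<Sum>i<n. complex_of_real (vec_index h i) * v i)"
      by (intro sums_sum sums_mult v) auto
    moreover have "scalar_prod h (x k) = (\<Sum>i<n. vec_index h i * vec_index (x k) i)" for k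
      using x[of k] by (simp add: scalar_prod_def lessThan_atLeast0)
    ultimately show ?thesis by (simp add: sum_divide_distrib)
  qed
  have "(\<lambda>k. complex_of_real (scalar_prod h (x (Suc k - 1))) / z ^ Suc k) sums H z"
    if "max B b + 1 \<le> norm z" for z
  proof -
    have "max B b < norm z" using that by linarith
    then show ?thesis using main[of z] by simp
  qed
  then show ?thesis unfolding impulse_response_def x_def[symmetric] eventually_at_infinity by blast
qed

section \<open>Poles of the transfer function\<close>

text \<open>If the order \<open>e\<close> of the root were less than \<open>m\<close>, write \<open>q = (x - a)\<^sup>e q'\<close> with \<open>q'(a) \<noteq> 0\<close>.
  Then \<open>q' (z - a)\<^sup>m H = (z - a)\<^bsup>m-e\<^esup> p\<close> would tend to \<open>0\<close> at \<open>a\<close>, although the left-hand side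
  tends to \<open>q'(a) L\<close>.\<close>
lemma pole_order_le_root_order:
  fixes q :: "real poly" and p :: "complex poly" and H u :: "complex \<Rightarrow> complex"
  assumes q: "q \<noteq> 0"
    and qH: "\<forall>z. poly (map_poly complex_of_real q) z \<noteq> 0 \<longrightarrow>
        poly (map_poly complex_of_real q) z * H z = poly p z"
    and lim: "((\<lambda>z. (z - complex_of_real a) ^ m * H z) \<longlongrightarrow> L) (at (complex_of_real a))"
    and L: "L \<noteq> 0"
  shows "m \<le> Polynomial.order a q"
proof (rule ccontr)
  assume "\<not> m \<le> Polynomial.order a q"
  define e where "e = Polynomial.order a q"
  then have em: "e < m" using \<open>\<not> m \<le> Polynomial.order a q\<close> by simp
  obtain q' where q': "q = [:- a, 1:] ^ e * q'" "\<not> [:- a, 1:] dvd q'"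
    using order_decomp[OF q, of a] e_def by auto
  define \<alpha> where "\<alpha> = complex_of_real a"
  let ?c = "map_poly complex_of_real"
  have "poly q' a \<noteq> 0" using q'(2) by (simp add: poly_eq_0_iff_dvd)
  then have c': "poly (?c q') \<alpha> \<noteq> 0" unfolding \<alpha>_def by (simp add: of_real_hom.poly_map_poly)
  interpret of_real_poly: map_poly_comm_ring_hom complex_of_real ..
  have cq: "poly (?c q) z = (z - \<alpha>) ^ e * poly (?c q') z" for z
    unfolding q'(1) \<alpha>_def by (simp add: of_real_poly.hom_mult of_real_poly.hom_power)
  have "?c q \<noteq> 0" using q by simp
  then have "\<forall>\<^sub>F z in at \<alpha>. poly (?c q) z \<noteq> 0"
    using poly_roots_finite[of "?c q"] islimpt_finite[of "{z. poly (?c q) z = 0}" \<alpha>]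
    by (auto simp: islimpt_iff_eventually)
  then have "\<forall>\<^sub>F z in at \<alpha>. (z - \<alpha>) ^ (m - e) * poly p z = poly (?c q') z * ((z - \<alpha>) ^ m * H z)"
  proof eventually_elim
    case (elim z)
    have "(z - \<alpha>) ^ (m - e) * poly p z = (z - \<alpha>) ^ (m - e) * ((z - \<alpha>) ^ e * poly (?c q') z * H z)"
      using qH[rule_format, OF elim] unfolding cq by simp
    also have "\<dots> = (z - \<alpha>) ^ ((m - e) + e) * poly (?c q') z * H z" unfolding power_add by simp
    finally show ?case using em by simp
  qed
  moreover have "((\<lambda>z. poly (?c q') z * ((z - \<alpha>) ^ m * H z)) \<longlongrightarrow> poly (?c q') \<alpha> * L) (at \<alpha>)"
    using lim unfolding \<alpha>_def[symmetric] by (intro tendsto_mult tendsto_poly tendsto_ident_at)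
  ultimately have "((\<lambda>z. (z - \<alpha>) ^ (m - e) * poly p z) \<longlongrightarrow> poly (?c q') \<alpha> * L) (at \<alpha>)"
    using tendsto_cong by force
  moreover have "((\<lambda>z. (z - \<alpha>) ^ (m - e) * poly p z) \<longlongrightarrow> (\<alpha> - \<alpha>) ^ (m - e) * poly p \<alpha>) (at \<alpha>)"
    by (intro tendsto_intros)
  ultimately have "poly (?c q') \<alpha> * L = (\<alpha> - \<alpha>) ^ (m - e) * poly p \<alpha>"
    using tendsto_unique[OF at_neq_bot] by blast
  then show False using c' L em by (simp add: power_0_left)
qed

lemma pole_leading_limit:
  fixes H :: "complex \<Rightarrow> complex"
  assumes "is_pole H a" "zorder H a = - int m" "H holomorphic_on S - {a}" "open S" "a \<in> S"
  obtains L where "L \<noteq> 0" "((\<lambda>z. (z - a) ^ m * H z) \<longlongrightarrow> L) (at a)"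
proof -
  define G where "G = zor_poly H a"
  have nz: "G a \<noteq> 0" and "\<exists>r>0. cball a r \<subseteq> S \<and> G holomorphic_on cball a r \<and>
      (\<forall>w\<in>cball a r - {a}. H w = G w / (w - a) ^ nat (- zorder H a) \<and> G w \<noteq> 0)"
    using zorder_exist_pole[OF assms(3-5,1)] unfolding G_def by auto
  then obtain r where r: "r > 0" "G holomorphic_on cball a r"
    "\<And>w. w \<in> cball a r - {a} \<Longrightarrow> H w = G w / (w - a) ^ m"
    unfolding assms(2) by auto
  have "\<forall>\<^sub>F z in at a. (z - a) ^ m * H z = G z"
    using eventually_at_in_open[OF open_ball, of a a r] r(1)
    by (auto elim!: eventually_mono simp: r(3))
  moreover have "isCont G a"
    using holomorphic_on_imp_continuous_on[OF r(2)] r(1)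
    by (metis continuous_on_interior centre_in_ball interior_cball)
  then have "(G \<longlongrightarrow> G a) (at a)" by (simp add: isCont_def)
  ultimately have "((\<lambda>z. (z - a) ^ m * H z) \<longlongrightarrow> G a) (at a)"
    using tendsto_cong by force
  then show ?thesis using that nz by blast
qed

text \<open>The poles of \<open>H\<close> at the \<open>lam j\<close> and the simple pole at \<open>1\<close> account for roots of the
  characteristic polynomial in any realization, whatever its dimension. When the dimension is
  the sum of the pole orders, they account for all its roots.\<close>
lemma positive_roots_char_poly:
  fixes H :: "complex \<Rightarrow> complex" and lam :: "nat \<Rightarrow> real" and coef :: "nat \<Rightarrow> nat \<Rightarrow> real"
  assumes real: "realization H n h F g"
    and form: "H = (\<lambda>z. 1 / (z - 1) +
          (\<Sum>j = 1..r. \<Sum>i = 1..m j. complex_of_real (coef j i) / (z - complex_of_real (lam j)) ^ i))"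
    and lam_range: "\<And>j. j \<in> {1..r} \<Longrightarrow> 0 < lam j \<and> lam j < 1"
    and lam_distinct: "inj_on lam {1..r}"
    and pole_order: "\<And>j. j \<in> {1..r} \<Longrightarrow>
          is_pole H (complex_of_real (lam j)) \<and> zorder H (complex_of_real (lam j)) = - int (m j)"
  shows "(\<Sum>j = 1..r. m j) + 1
    \<le> (\<Sum>x | 0 < x \<and> poly (char_poly F) x = 0. Polynomial.order x (char_poly F))"
proof -
  define q where "q = char_poly F"
  have F: "F \<in> carrier_mat n n" using real unfolding realization_def by simp
  have q0: "q \<noteq> 0" unfolding q_def using degree_monic_char_poly[OF F] by auto
  obtain p where p: "\<forall>z. poly (map_poly complex_of_real q) z \<noteq> 0 \<longrightarrow>
      poly (map_poly complex_of_real q) z * H z = poly p z"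
    using realization_numerator[OF real] unfolding q_def by blast
  have ord_lam: "m j \<le> Polynomial.order (lam j) q" if j: "j \<in> {1..r}" for j
  proof -
    let ?a = "complex_of_real (lam j)"
    define S where "S = - (insert 1 (complex_of_real ` lam ` {1..r}) - {?a})"
    have "open S" unfolding S_def by (intro open_Compl finite_imp_closed) auto
    moreover have "?a \<in> S" unfolding S_def by simp
    moreover have "H holomorphic_on S - {?a}"
      unfolding form S_def by (intro holomorphic_intros) auto
    ultimately obtain L where "L \<noteq> 0" "((\<lambda>z. (z - ?a) ^ m j * H z) \<longlongrightarrow> L) (at ?a)"
      using pole_leading_limit[of H ?a "m j" S] pole_order[OF j] by blast
    then show ?thesis using pole_order_le_root_order[OF q0 p] by blast
  qed
  have ord_1: "1 \<le> Polynomial.order 1 q"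
  proof -
    define K where "K = (\<lambda>z. \<Sum>j = 1..r. \<Sum>i = 1..m j. complex_of_real (coef j i) / (z - complex_of_real (lam j)) ^ i)"
    have "1 \<noteq> complex_of_real (lam j)" if "j \<in> {1..r}" for j
      using lam_range[OF that] by (metis less_irrefl of_real_eq_1_iff)
    then have "((\<lambda>z. 1 + (z - 1) * K z) \<longlongrightarrow> 1 + (1 - 1) * K 1) (at 1)"
      unfolding K_def by (intro tendsto_intros) auto
    moreover have "\<forall>\<^sub>F z in at 1. 1 + (z - 1) * K z = (z - complex_of_real 1) ^ 1 * H z"
      unfolding eventually_at_filter form K_def by (intro always_eventually) (auto simp: algebra_simps)
    ultimately have "((\<lambda>z. (z - complex_of_real 1) ^ 1 * H z) \<longlongrightarrow> 1) (at (complex_of_real 1))"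
      using tendsto_cong by force
    then show ?thesis by (rule pole_order_le_root_order[OF q0 p]) simp
  qed
  have nin: "1 \<notin> lam ` {1..r}" using lam_range by force
  have "(\<Sum>j = 1..r. m j) + 1 \<le> (\<Sum>j = 1..r. Polynomial.order (lam j) q) + Polynomial.order 1 q"
    using ord_1 ord_lam by (intro add_mono sum_mono) auto
  also have "\<dots> = (\<Sum>x\<in>insert 1 (lam ` {1..r}). Polynomial.order x q)"
    using nin by (simp add: sum.reindex[OF lam_distinct] del: One_nat_def)
  also have "\<dots> = (\<Sum>x\<in>insert 1 (lam ` {1..r}) \<inter> {x. 0 < x \<and> poly q x = 0}. Polynomial.order x q)"
    by (rule sum.mono_neutral_right) (use q0 lam_range in \<open>auto simp: order_root\<close>)
  also have "\<dots> \<le> (\<Sum>x | 0 < x \<and> poly q x = 0. Polynomial.order x q)"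
    by (rule sum_mono2) (auto intro: finite_subset[OF _ poly_roots_finite[OF q0]])
  finally show ?thesis unfolding q_def .
qed

section \<open>The dimension bound\<close>

lemma funpow_transpose_scalar_prod:
  fixes A :: "real mat"
  assumes A: "A \<in> carrier_mat n n" and c: "c \<in> carrier_vec n" and b: "b \<in> carrier_vec n"
  shows "scalar_prod (((*\<^sub>v) (transpose_mat A) ^^ k) c) (((*\<^sub>v) A ^^ l) b) =
    scalar_prod c (((*\<^sub>v) A ^^ (k + l)) b)"
proof (induction k arbitrary: l)
  case (Suc k)
  let ?d = "((*\<^sub>v) (transpose_mat A) ^^ k) c" and ?x = "((*\<^sub>v) A ^^ l) b"
  have d: "?d \<in> carrier_vec n" using A c by (intro mult_mat_vec_funpow_carrier) auto
  have x: "?x \<in> carrier_vec n" using A b by (intro mult_mat_vec_funpow_carrier) auto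
  have "scalar_prod (((*\<^sub>v) (transpose_mat A) ^^ Suc k) c) ?x = scalar_prod (transpose_mat A *\<^sub>v ?d) ?x"
    by simp
  also have "\<dots> = scalar_prod ?d (A *\<^sub>v ?x)"
    using transpose_vec_mult_scalar[OF A x d] A x d by (simp add: comm_scalar_prod[of _ n])
  also have "\<dots> = scalar_prod ?d (((*\<^sub>v) A ^^ Suc l) b)" by simp
  also have "\<dots> = scalar_prod c (((*\<^sub>v) A ^^ (Suc k + l)) b)" using Suc.IH[of "Suc l"] by simp
  finally show ?case .
qed simp

lemma funpow_intertwine:
  assumes F: "F \<in> carrier_mat n n" and A: "A \<in> carrier_mat m m" and P: "P \<in> carrier_mat n m"
    and FP: "F * P = P * A" and x: "x \<in> carrier_vec m"
  shows "P *\<^sub>v (((*\<^sub>v) A ^^ k) x) = ((*\<^sub>v) F ^^ k) (P *\<^sub>v x)"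
proof (induction k)
  case (Suc k)
  let ?x = "((*\<^sub>v) A ^^ k) x"
  have y: "?x \<in> carrier_vec m" using A x by (rule mult_mat_vec_funpow_carrier)
  have "P *\<^sub>v (((*\<^sub>v) A ^^ Suc k) x) = (P * A) *\<^sub>v ?x" using P A y by simp
  also have "\<dots> = F *\<^sub>v (P *\<^sub>v ?x)" unfolding FP[symmetric] using F P y by simp
  finally show ?case using Suc by simp
qed simp

lemma nonneg_funpow:
  fixes A :: "real mat"
  assumes A: "A \<in> carrier_mat n n" and x: "x \<in> carrier_vec n"
    and A0: "\<And>i j. i < n \<Longrightarrow> j < n \<Longrightarrow> 0 \<le> A $$ (i, j)" and x0: "\<And>i. i < n \<Longrightarrow> 0 \<le> vec_index x i"
    and i: "i < n"
  shows "0 \<le> vec_index (((*\<^sub>v) A ^^ k) x) i"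
  using i
proof (induction k arbitrary: i)
  case (Suc k)
  have "vec_index (((*\<^sub>v) A ^^ Suc k) x) i = (\<Sum>j<n. A $$ (i, j) * vec_index (((*\<^sub>v) A ^^ k) x) j)"
    using mult_mat_vec_index[OF A mult_mat_vec_funpow_carrier[OF A x, of k] Suc.prems] by simp
  then show ?case using Suc A0 by (auto intro!: sum_nonneg mult_nonneg_nonneg)
qed (use x0 in simp)

text \<open>The counting step. The sum over coordinates of \<open>(c\<^sup>T A\<^sup>k)\<^sub>i (A\<^bsup>K-k\<^esup> b)\<^sub>i\<close> is \<open>c\<^sup>T A\<^sup>K b = 0\<close>
  for each \<open>k \<le> K\<close>, while with \<open>k + 1\<close> in place of \<open>k\<close> in the first factor it is positive. A
  coordinate that contributes to the second sum has a zero at \<open>k\<close> but does not vanish identically,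
  so the indices \<open>0, ..., K\<close> are covered by the zeros of at most \<open>M\<close> nonzero
  sequences, each of which has at most \<open>N\<close> zeros by the last hypothesis.\<close>
lemma annihilation_count:
  fixes A :: "real mat"
  assumes A: "A \<in> carrier_mat M M" and c: "c \<in> carrier_vec M" and b: "b \<in> carrier_vec M"
    and nn: "nonneg_triple c A b"
    and zero: "scalar_prod c (((*\<^sub>v) A ^^ K) b) = 0"
    and pos: "scalar_prod c (((*\<^sub>v) A ^^ Suc K) b) > 0"
    and few: "\<And>i Z. i < M \<Longrightarrow> finite Z \<Longrightarrow> (\<And>k. k \<in> Z \<Longrightarrow> vec_index (((*\<^sub>v) (transpose_mat A) ^^ k) c) i = 0) \<Longrightarrow>
       card Z = Suc N \<Longrightarrow> (\<And>k. vec_index (((*\<^sub>v) (transpose_mat A) ^^ k) c) i = 0)"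
  shows "Suc K \<le> M * N"
proof -
  define d where "d k = ((*\<^sub>v) (transpose_mat A) ^^ k) c" for k
  define x where "x k = ((*\<^sub>v) A ^^ k) b" for k
  have d: "d k \<in> carrier_vec M" and x: "x k \<in> carrier_vec M" for k
    using mult_mat_vec_funpow_carrier[of A M b k] mult_mat_vec_funpow_carrier[of "transpose_mat A" M c k] A b c
    unfolding d_def x_def by auto
  have prod: "(\<Sum>i<M. vec_index (d k) i * vec_index (x l) i) = scalar_prod c (((*\<^sub>v) A ^^ (k + l)) b)" for k l
    using funpow_transpose_scalar_prod[OF A c b, of k l] x[of l]
    by (simp add: d_def x_def scalar_prod_def lessThan_atLeast0)
  have d0: "0 \<le> vec_index (d k) i" if "i < M" for k i
    unfolding d_def using nn A c that by (intro nonneg_funpow[of _ M]) (auto simp: nonneg_triple_def)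
  have x0: "0 \<le> vec_index (x k) i" if "i < M" for k i
    unfolding x_def using nn A b that by (intro nonneg_funpow[of _ M]) (auto simp: nonneg_triple_def)
  define Z where "Z i = {k. k \<le> K \<and> vec_index (d k) i = 0}" for i
  define I where "I = {i. i < M \<and> (\<exists>k. vec_index (d k) i \<noteq> 0)}"
  have finZ: "finite (Z i)" for i unfolding Z_def by simp
  have cardZ: "card (Z i) \<le> N" if i: "i \<in> I" for i
  proof (rule ccontr)
    assume "\<not> card (Z i) \<le> N"
    then have "Suc N \<le> card (Z i)" by simp
    then obtain Y where Y: "Y \<subseteq> Z i" "card Y = Suc N" by (metis obtain_subset_with_card_n)
    have "vec_index (d k) i = 0" for k
      using few[of i Y k] i Y finite_subset[OF Y(1) finZ] unfolding I_def Z_def d_def by blast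
    then show False using i unfolding I_def by simp
  qed
  have "{..K} \<subseteq> (\<Union>i\<in>I. Z i)"
  proof
    fix k assume "k \<in> {..K}"
    then have k: "k \<le> K" by simp
    have "(\<Sum>i<M. vec_index (d (Suc k)) i * vec_index (x (K - k)) i) > 0"
      unfolding prod using pos k by simp
    then obtain i where i: "i < M" "vec_index (d (Suc k)) i * vec_index (x (K - k)) i \<noteq> 0"
      by (metis (no_types, lifting) less_irrefl lessThan_iff sum.neutral)
    have "(\<Sum>i<M. vec_index (d k) i * vec_index (x (K - k)) i) = 0"
      unfolding prod using zero k by simp
    then have "vec_index (d k) i * vec_index (x (K - k)) i = 0"
      using i(1) d0 x0 by (subst (asm) sum_nonneg_eq_0_iff) auto
    then show "k \<in> (\<Union>i\<in>I. Z i)" using i k unfolding I_def Z_def by auto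
  qed
  then have "card {..K} \<le> card (\<Union>i\<in>I. Z i)"
    using finZ by (intro card_mono) (auto simp: I_def)
  also have "\<dots> \<le> (\<Sum>i\<in>I. card (Z i))" by (rule card_UN_le) (simp add: I_def)
  also have "\<dots> \<le> (\<Sum>i\<in>I. N)" by (rule sum_mono) (rule cardZ)
  also have "\<dots> \<le> M * N" using card_mono[of "{..<M}" I] by (auto simp: I_def)
  finally show ?thesis by simp
qed

text \<open>The sequences \<open>y\<close> below are the coordinates of \<open>h\<^sup>T F\<^sup>k\<close>; paired with the columns of \<open>P\<close>, the
  generators of the cone, they give the coordinates of \<open>c\<^sup>T A\<^sup>k\<close>.\<close>
theorem theorem4p2:
  fixes H :: "complex \<Rightarrow> complex"
    and n r k0 M :: nat
    and m :: "nat \<Rightarrow> nat"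
    and lam :: "nat \<Rightarrow> real"
    and coef :: "nat \<Rightarrow> nat \<Rightarrow> real"
    and t :: "nat \<Rightarrow> real"
    and c b :: "real Matrix.vec"
    and A :: "real mat"
  assumes degree: "mcmillan_degree H = n"
    and form: "H = (\<lambda>z. 1 / (z - 1) +
          (\<Sum>j = 1..r. \<Sum>i = 1..m j. complex_of_real (coef j i) / (z - complex_of_real (lam j)) ^ i))"
    and lam_range: "\<And>j. j \<in> {1..r} \<Longrightarrow> 0 < lam j \<and> lam j < 1"
    and lam_distinct: "inj_on lam {1..r}"
    and pole_order: "\<And>j. j \<in> {1..r} \<Longrightarrow>
          is_pole H (complex_of_real (lam j)) \<and> zorder H (complex_of_real (lam j)) = - int (m j)"
    and order_sum: "(\<Sum>j = 1..r. m j) + 1 = n"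
    and impulse: "impulse_response H t"
    and k0_pos: "k0 \<ge> 1"
    and t_zero: "t k0 = 0"
    and t_pos: "\<And>k. k > k0 \<Longrightarrow> t k > 0"
    and cone: "cone_generated_realization H M c A b"
  shows "real M \<ge> real k0 / (real n - 1)"
proof -
  obtain h F g P where A: "A \<in> carrier_mat M M" and c: "c \<in> carrier_vec M" and b: "b \<in> carrier_vec M"
    and nn: "nonneg_triple c A b" and real: "realization H n h F g" and P: "P \<in> carrier_mat n M"
    and FP: "F * P = P * A" and Pb: "P *\<^sub>v b = g" and cP: "c = transpose_mat P *\<^sub>v h"
    using cone degree unfolding cone_generated_realization_def minimal_realization_def by blast
  have F: "F \<in> carrier_mat n n" and h: "h \<in> carrier_vec n" and g: "g \<in> carrier_vec n"
    using real unfolding realization_def by auto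
  define q where "q = char_poly F"
  have deg_q: "degree q = n" and q0: "q \<noteq> 0" using degree_monic_char_poly[OF F] by (auto simp: q_def)
  have roots: "degree q \<le> (\<Sum>x | 0 < x \<and> poly q x = 0. Polynomial.order x q)"
    using positive_roots_char_poly[OF real form lam_range lam_distinct pole_order] order_sum
    unfolding deg_q by (simp add: q_def)
  have response: "t (Suc k) = scalar_prod c (((*\<^sub>v) A ^^ k) b)" for k
  proof -
    let ?x = "((*\<^sub>v) A ^^ k) b"
    have x: "?x \<in> carrier_vec M" using A b by (rule mult_mat_vec_funpow_carrier)
    have "t (Suc k) = scalar_prod h (((*\<^sub>v) F ^^ k) g)"
      using impulse_response_unique[OF impulse realization_impulse_response[OF real]] by simp
    also have "\<dots> = scalar_prod h (P *\<^sub>v ?x)" using funpow_intertwine[OF F A P FP b] Pb by simp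
    also have "\<dots> = scalar_prod c ?x"
      unfolding cP using transpose_vec_mult_scalar[OF P x h] P x h by (simp add: comm_scalar_prod[of _ n] comm_scalar_prod[of _ M])
    finally show ?thesis .
  qed
  define y where "y k l = vec_index (((*\<^sub>v) (transpose_mat F) ^^ k) h) l" for k l
  have y_step: "y (Suc k) l = (\<Sum>i<n. F $$ (i, l) * y k i)" if l: "l < n" for k l
    using mult_mat_vec_index[of "transpose_mat F" n n "((*\<^sub>v) (transpose_mat F) ^^ k) h" l]
      mult_mat_vec_funpow_carrier[of "transpose_mat F" n h k] F h l
    by (simp add: y_def)
  have ann: "moment (\<lambda>k. y k l) (q * p) = 0" if "l < n" for l p
    unfolding q_def using F y_step that by (rule moment_char_poly_eq_0)
  have vertex: "vec_index (((*\<^sub>v) (transpose_mat A) ^^ k) c) i = (\<Sum>l<n. P $$ (l, i) * y k l)" if i: "i < M" for k i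
  proof -
    have "transpose_mat A * transpose_mat P = transpose_mat P * transpose_mat F"
      using arg_cong[OF FP, of transpose_mat] F A P by (simp add: transpose_mult)
    then have "((*\<^sub>v) (transpose_mat A) ^^ k) c = transpose_mat P *\<^sub>v (((*\<^sub>v) (transpose_mat F) ^^ k) h)"
      unfolding cP using F A P h by (intro funpow_intertwine[of _ M _ n, symmetric]) auto
    then show ?thesis
      using mult_mat_vec_index[of "transpose_mat P" M n "((*\<^sub>v) (transpose_mat F) ^^ k) h" i]
        mult_mat_vec_funpow_carrier[of "transpose_mat F" n h k] F P h i
      by (simp add: y_def)
  qed
  have "Suc (k0 - 1) \<le> M * (n - 1)"
  proof (rule annihilation_count[OF A c b nn])
    show "scalar_prod c (((*\<^sub>v) A ^^ (k0 - 1)) b) = 0" using response[of "k0 - 1"] t_zero k0_pos by simp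
    show "scalar_prod c (((*\<^sub>v) A ^^ Suc (k0 - 1)) b) > 0" using response[of k0] t_pos[of "Suc k0"] k0_pos by simp
    fix i Z k assume i: "i < M" and Z: "finite Z"
      "\<And>k. k \<in> Z \<Longrightarrow> vec_index (((*\<^sub>v) (transpose_mat A) ^^ k) c) i = 0" "card Z = Suc (n - 1)"
    show "vec_index (((*\<^sub>v) (transpose_mat A) ^^ k) c) i = 0"
    proof (rule recurrence_zero_bound[OF q0 roots _ Z(1) _ Z(2)])
      show "moment (\<lambda>k. vec_index (((*\<^sub>v) (transpose_mat A) ^^ k) c) i) (q * p) = 0" for p
        unfolding vertex[OF i] moment_sequence_sum by (simp add: ann)
      show "card Z = degree q" using Z(3) order_sum deg_q by simp
    qed
  qed
  then have "k0 \<le> M * (n - 1)" using k0_pos by simp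
  then have "real k0 \<le> real M * real (n - 1)" by (metis of_nat_le_iff of_nat_mult)
  then have "real k0 \<le> real M * (real n - 1)" using order_sum by (simp add: of_nat_diff)
  then show ?thesis
    \<comment> \<open>For \<open>n = 1\<close> the quotient is a division by 0, hence 0.\<close>
    using order_sum by (cases "n = 1") (auto simp: pos_divide_le_eq)
qed

end
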